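(* Let $t \ge 4$ be even and let $n \ge 4t + 12$ with $n \equiv 4 \pmod 8$. Let \[ S''_{t, n} = \{1, 2, \ldots, t-1 \} \cup \left\{ \tfrac{n}{4} - 1, \tfrac{n}{4} + 3 \right\} \cup \left\{\tfrac{n}{2} - (t-1), \ldots, \tfrac{n}{2} - 2, \tfrac{n}{2} -1 \right\}. \] Then the circulant graph $\mathrm{Circ}(n, S''_{t, n})$ is a $4t$-regular circulant nut graph of order $n$.
   Context: For $n \ge 2$ and $S \subseteq \{1, 2, \ldots, \lfloor n/2 \rfloor\}$, $\mathrm{Circ}(n, S)$ denotes the simple graph on vertex set $\{0, 1, \ldots, n-1\}$ in which distinct vertices $i, j$ are adjacent if and only if $(j - i) \bmod n \in S$ or $(i - j) \bmod n \in S$. A nut graph is a graph with at least two vertices whose adjacency matrix has nullity exactly one and such that a nonzero vector spanning its null space has no zero entries; a circulant nut graph is a nut graph that is a circulant graph. *)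

theory Defs
  imports "Graph_Theory.Graph_Theory" "Jordan_Normal_Form.Matrix_Kernel"
begin

text \<open>
  Simple graphs are values of type \<^typ>\<open>'a pair_pre_digraph\<close> satisfying the locale predicate
  \<^const>\<open>pair_graph\<close>: finite, loop-free, with a symmetric set of arcs (each edge is represented
  by its two orientations).
\<close>

text \<open>The differences are taken in \<^typ>\<open>int\<close>, because subtraction truncates on \<^typ>\<open>nat\<close>.\<close>

definition Circ :: "nat \<Rightarrow> nat set \<Rightarrow> nat pair_pre_digraph" where
  "Circ n S = \<lparr> pverts = {0..<n},
     parcs = {(i, j). i < n \<and> j < n \<and> i \<noteq> j \<and>
       ((int j - int i) mod int n \<in> int ` S \<or> (int i - int j) mod int n \<in> int ` S)} \<rparr>"

definition circulant_graph :: "'a pair_pre_digraph \<Rightarrow> bool" where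
  "circulant_graph G \<longleftrightarrow>
     (\<exists>n S. n \<ge> 2 \<and> S \<subseteq> {1..n div 2} \<and> digraph_iso (with_proj (Circ n S)) (with_proj G))"

text \<open>As the arc set is symmetric, the out-degree of a vertex is its degree.\<close>

definition regular_graph :: "nat \<Rightarrow> 'a pair_pre_digraph \<Rightarrow> bool" where
  "regular_graph k G \<longleftrightarrow> pair_graph G \<and> (\<forall>v\<in>pverts G. out_degree (with_proj G) v = k)"

text \<open>
  Rows and columns are indexed by the vertices in increasing order. Any other ordering permutes
  rows and columns simultaneously, which does not affect whether a graph is a nut graph.
\<close>

definition adjacency_matrix :: "'a::linorder pair_pre_digraph \<Rightarrow> real mat" where
  "adjacency_matrix G =
     (let vs = sorted_list_of_set (pverts G); n = card (pverts G)
      in mat n n (\<lambda>(i, j). if (vs ! i, vs ! j) \<in> parcs G then 1 else 0))"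

text \<open>
  When the nullity is one, the vectors spanning the null space are exactly its nonzero elements.
\<close>

definition nut_graph :: "'a::linorder pair_pre_digraph \<Rightarrow> bool" where
  "nut_graph G \<longleftrightarrow> pair_graph G \<and> card (pverts G) \<ge> 2 \<and>
     kernel_dim (adjacency_matrix G) = 1 \<and>
     (\<forall>x \<in> mat_kernel (adjacency_matrix G). x \<noteq> 0\<^sub>v (card (pverts G)) \<longrightarrow>
        (\<forall>i < card (pverts G). vec_index x i \<noteq> 0))"

definition circulant_nut_graph :: "'a::linorder pair_pre_digraph \<Rightarrow> bool" where
  "circulant_nut_graph G \<longleftrightarrow> nut_graph G \<and> circulant_graph G"

text \<open>
  The set $S''_{t,n}$. It is used only for \<open>4 dvd n\<close> and \<open>n \<ge> 4 * t + 12\<close>, where the divisions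
  are exact and no subtraction truncates.
\<close>

definition S2 :: "nat \<Rightarrow> nat \<Rightarrow> nat set" where
  "S2 t n = {1..t - 1} \<union> {n div 4 - 1, n div 4 + 3} \<union> {n div 2 - (t - 1)..n div 2 - 1}"

lemma S2_subset:
  assumes "t \<ge> 4" and "n \<ge> 4 * t + 12"
  shows "S2 t n \<subseteq> {1..n div 2}"
  using assms by (auto simp: S2_def)

lemma pair_graph_Circ: "pair_graph (Circ n S)"
proof
  show "finite (parcs (Circ n S))"
    by (rule finite_subset[of _ "{0..<n} \<times> {0..<n}"]) (auto simp: Circ_def)
qed (auto simp: Circ_def symmetric_def sym_def)

end

theory Submission
  imports Defs "HOL-Library.Periodic_Fun"
begin

text \<open>
  Write \<open>n = 4q\<close> with \<open>q\<close> odd and regard a null vector as an \<open>n\<close>-periodic function \<open>f\<close> on the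
  integers, with shift operator \<open>T\<close>. On the part of \<open>f\<close> with \<open>T\<^sup>2\<^sup>q = -1\<close> only the two middle
  elements of $S''_{t,n}$ contribute, and their contribution factors into operators that are
  invertible because \<open>q\<close> is odd; so \<open>f\<close> is \<open>2q\<close>-periodic. The equation then becomes
  \<open>(1 + T\<^sup>2)(1 + T\<^sup>4) f = 2 B f\<close> for an integral operator \<open>B\<close>. Since \<open>T\<^sup>2\<close> has odd order,
  \<open>(1 + T\<^sup>2)(1 + T\<^sup>4)\<close> is invertible over the integers on the image of \<open>1 - T\<^sup>2\<close>, so
  \<open>y = (1 - T\<^sup>2) f\<close> satisfies \<open>y = 2 C y\<close> with \<open>C\<close> integral. Because \<open>1 - 2C\<close> is invertible
  modulo 2, \<open>y = 0\<close>, hence \<open>f\<close> has period 2, and for such \<open>f\<close> the equation reads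
  \<open>2t (f(i) + f(i + 1)) = 0\<close>.
\<close>

section \<open>Integer matrices congruent to the identity modulo 2\<close>

text \<open>Gaussian elimination preserves the parity pattern of the matrix.\<close>

lemma odd_diagonal_even_off_diagonal_solution_zero:
  fixes M :: "'a \<Rightarrow> 'a \<Rightarrow> int" and y :: "'a \<Rightarrow> real"
  assumes "finite I"
    and "\<And>i. i \<in> I \<Longrightarrow> odd (M i i)"
    and "\<And>i j. i \<in> I \<Longrightarrow> j \<in> I \<Longrightarrow> i \<noteq> j \<Longrightarrow> even (M i j)"
    and "\<And>i. i \<in> I \<Longrightarrow> (\<Sum>j\<in>I. of_int (M i j) * y j) = 0"
  shows "\<forall>i\<in>I. y i = 0"
  using assms
proof (induction I arbitrary: M rule: finite_induct)
  case (insert k I)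
  \<comment> \<open>Elimination of the unknown \<open>k\<close> without division, so that the
    entries stay integers and parities make sense.\<close>
  define M' where "M' i j = M k k * M i j - M i k * M k j" for i j
  have eq: "of_int (M i k) * y k + (\<Sum>j\<in>I. of_int (M i j) * y j) = 0" if "i \<in> insert k I" for i
    using insert.prems(3)[OF that] insert.hyps by simp
  have "\<forall>i\<in>I. y i = 0"
  proof (rule insert.IH[of M'])
    fix i assume i: "i \<in> I"
    then have ik: "i \<noteq> k" using insert.hyps by auto
    show "odd (M' i i)"
      using insert.prems(1)[of i] insert.prems(1)[of k] insert.prems(2)[of i k] i ik
      by (simp add: M'_def)
    have "(\<Sum>j\<in>I. of_int (M' i j) * y j) = of_int (M k k) * (\<Sum>j\<in>I. of_int (M i j) * y j)
        - of_int (M i k) * (\<Sum>j\<in>I. of_int (M k j) * y j)"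
      by (simp add: M'_def sum_distrib_left sum_subtractf[symmetric] algebra_simps)
    moreover have "(\<Sum>j\<in>I. of_int (M i j) * y j) = - (of_int (M i k) * y k)"
      using eq[of i] i by simp
    moreover have "(\<Sum>j\<in>I. of_int (M k j) * y j) = - (of_int (M k k) * y k)"
      using eq[of k] by simp
    ultimately show "(\<Sum>j\<in>I. of_int (M' i j) * y j) = 0" by simp
  next
    fix i j assume "i \<in> I" "j \<in> I" "i \<noteq> j"
    then show "even (M' i j)"
      using insert.prems(2)[of i j] insert.prems(2)[of i k] insert.hyps by (auto simp: M'_def)
  qed
  moreover have "M k k \<noteq> 0" using insert.prems(1)[of k] by auto
  ultimately show ?case using eq[of k] by simp
qed simp

text \<open>Halving is vacuous in the real span of a set, but not in its integer span; the reals are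
  therefore taken as a module over the integers.\<close>

interpretation int_module: Modules.module "\<lambda>(c::int) (x::real). of_int c * x"
  by unfold_locales (simp_all add: algebra_simps)

text \<open>Expanding each \<open>y\<close> as twice an integer combination of \<open>Y\<close>
  gives a homogeneous system with matrix \<open>1 - 2 * c\<close>, the identity modulo 2.\<close>

lemma int_span_two_divisible_imp_zero:
  assumes "finite Y" and two: "\<And>y. y \<in> Y \<Longrightarrow> \<exists>w\<in>int_module.span Y. y = 2 * w"
  shows "Y \<subseteq> {0}"
proof -
  have "\<exists>c. y = 2 * (\<Sum>v\<in>Y. of_int (c v) * v)" if "y \<in> Y" for y
    using two[OF that] by (auto simp: int_module.span_finite[OF assms(1)])
  then obtain c where c: "\<And>y. y \<in> Y \<Longrightarrow> y = 2 * (\<Sum>v\<in>Y. of_int (c y v) * v)"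
    by metis
  have "\<forall>y\<in>Y. id y = 0"
  proof (rule odd_diagonal_even_off_diagonal_solution_zero
      [where M = "\<lambda>y v. (if v = y then 1 else 0) - 2 * c y v"])
    fix y assume y: "y \<in> Y"
    have "(\<Sum>v\<in>Y. of_int ((if v = y then 1 else 0) - 2 * c y v) * id v)
        = (\<Sum>v\<in>Y. (if v = y then v else 0) - 2 * (of_int (c y v) * v))"
      by (rule sum.cong) (auto simp: algebra_simps)
    also have "\<dots> = y - 2 * (\<Sum>v\<in>Y. of_int (c y v) * v)"
      using y \<open>finite Y\<close> by (simp add: sum_subtractf sum_distrib_left)
    also have "\<dots> = 0" using c[OF y] by simp
    finally show "(\<Sum>v\<in>Y. of_int ((if v = y then 1 else 0) - 2 * c y v) * id v) = (0::real)" .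
  qed (use \<open>finite Y\<close> in auto)
  then show ?thesis by auto
qed

section \<open>Periodic functions on the integers\<close>

lemma periodic_int_mult:
  fixes f :: "int \<Rightarrow> 'a"
  assumes "\<And>i. f (i + p) = f i"
  shows "f (i + k * p) = f i"
proof -
  interpret periodic_fun_simple f p by unfold_locales (rule assms)
  show ?thesis using plus_of_int[of i k] by simp
qed

lemma finite_range_periodic:
  fixes f :: "int \<Rightarrow> 'a"
  assumes "p > 0" and per: "\<And>i. f (i + p) = f i"
  shows "finite (range f)"
proof -
  have "f i \<in> f ` {0..<p}" for i
  proof -
    have "f i = f (i mod p + (i div p) * p)" by simp
    also have "\<dots> = f (i mod p)" by (rule periodic_int_mult) (rule per)
    finally show ?thesis using \<open>p > 0\<close> by simp
  qed
  then have "range f \<subseteq> f ` {0..<p}" by auto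
  then show ?thesis by (rule finite_subset) simp
qed

text \<open>An odd number of shifts by \<open>p\<close> negates \<open>f\<close>, yet
  \<open>m\<close> of them fix it.\<close>

lemma antiperiodic_odd_mult_periodic_imp_zero:
  fixes f :: "int \<Rightarrow> real"
  assumes "odd m" and anti: "\<And>i. f (i + p) = - f i" and per: "\<And>i. f (i + m * p) = f i"
  shows "f i = 0"
proof -
  have per2: "f (j + 2 * p) = f j" for j
    using anti[of j] anti[of "j + p"] by (simp add: algebra_simps)
  obtain l where l: "m = 2 * l + 1" using \<open>odd m\<close> by (elim oddE)
  have "f (i + m * p) = f ((i + p) + l * (2 * p))"
    by (simp add: l algebra_simps)
  also have "\<dots> = f (i + p)" by (rule periodic_int_mult) (rule per2)
  finally show ?thesis using per[of i] anti[of i] by simp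
qed

section \<open>Solutions of the null-vector equation\<close>

text \<open>
  For \<open>f\<close> of period \<open>4q\<close>, this is the sum of \<open>f\<close> over the neighbours of the vertex \<open>i\<close> in
  the graph $\mathrm{Circ}(4q, S''_{t,4q})$.
\<close>

definition nbr_sum :: "nat \<Rightarrow> int \<Rightarrow> (int \<Rightarrow> real) \<Rightarrow> int \<Rightarrow> real" where
  "nbr_sum t q f i =
     (\<Sum>s = 1..t - 1. f (i + int s) + f (i - int s) + f (i + (2 * q - int s)) + f (i - (2 * q - int s)))
     + f (i + (q - 1)) + f (i - (q - 1)) + f (i + (q + 3)) + f (i - (q + 3))"

lemma nbr_sum_eq_0_imp_half_periodic:
  assumes "odd q" and per: "\<And>i. f (i + 4 * q) = f i" and zero: "\<And>i. nbr_sum t q f i = 0"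
  shows "f (i + 2 * q) = f i"
proof -
  define h where "h i = f i - f (i + 2 * q)" for i
  have f2: "f (i - 2 * q) = f (i + 2 * q)" for i
    using per[of "i - 2 * q"] by (simp add: algebra_simps)
  have h2: "h (i + 2 * q) = - h i" for i
    using per[of i] by (simp add: h_def algebra_simps)
  \<comment> \<open>The shift by \<open>2 * q\<close> only permutes the four terms belonging to
    \<open>s\<close>, so they cancel in the difference.\<close>
  have sym: "(\<Sum>s = 1..t - 1. f (i + 2 * q + int s) + f (i + 2 * q - int s)
        + f (i + 2 * q + (2 * q - int s)) + f (i + 2 * q - (2 * q - int s)))
      = (\<Sum>s = 1..t - 1. f (i + int s) + f (i - int s)
        + f (i + (2 * q - int s)) + f (i - (2 * q - int s)))" for i
  proof (rule sum.cong)
    fix s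
    show "f (i + 2 * q + int s) + f (i + 2 * q - int s)
        + f (i + 2 * q + (2 * q - int s)) + f (i + 2 * q - (2 * q - int s))
      = f (i + int s) + f (i - int s) + f (i + (2 * q - int s)) + f (i - (2 * q - int s))"
      using per[of "i - int s"] f2[of "i + int s"] by (simp add: algebra_simps)
  qed simp
  \<comment> \<open>subtract the equations at \<open>i\<close> and \<open>i + 2 * q\<close>\<close>
  have hsum: "h (i + (q - 1)) + h (i - (q - 1)) + h (i + (q + 3)) + h (i - (q + 3)) = 0" for i
    using zero[of i] zero[of "i + 2 * q"] sym[of i]
    unfolding nbr_sum_def h_def by (simp add: algebra_simps)
  \<comment> \<open>By \<open>h2\<close> the four-term equation becomes
    \<open>h (i + 2) - h i + h (i + 6) - h (i + 4) = 0\<close>, that is,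
    \<open>(T^4 + 1) (T^2 - 1) h = 0\<close>.\<close>
  define d where "d i = h (i + 2) - h i" for i
  have "d i = 0" for i
  proof (rule antiperiodic_odd_mult_periodic_imp_zero[OF \<open>odd q\<close>])
    fix i
    show "d (i + 4) = - d i"
      using hsum[of "i + 3 - q"] h2[of "i + 4 - 2 * q"] h2[of "i - 2 * q"]
      by (simp add: d_def algebra_simps)
    show "d (i + q * 4) = d i"
      using per[of i] per[of "i + 2"] per[of "i + 2 * q"] per[of "i + 2 + 2 * q"]
      by (simp add: d_def h_def algebra_simps)
  qed
  then have "h (i + 2) = h i" for i by (simp add: d_def)
  \<comment> \<open>Period 2 makes \<open>h\<close> also \<open>2 * q\<close>-periodic, while
    \<open>h2\<close> makes it antiperiodic with the same shift.\<close>
  then have "h (i + q * 2) = h i" for i by (rule periodic_int_mult)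
  then have "h i = 0" using h2[of i] by (simp add: mult.commute)
  then show ?thesis by (simp add: h_def)
qed

lemma nbr_sum_eq_0_imp_periodic_2:
  assumes "odd q" and "q > 0" and per: "\<And>i. f (i + 4 * q) = f i"
    and zero: "\<And>i. nbr_sum t q f i = 0"
  shows "f (i + 2) = f i"
proof -
  have per2: "f (i + 2 * q) = f i" for i
    by (rule nbr_sum_eq_0_imp_half_periodic[OF assms(1,3,4)])
  have per2': "f (i - 2 * q) = f i" for i
    using per2[of "i - 2 * q"] by simp
  define B where "B i = (\<Sum>s = 1..t - 1. f (i + int s) + f (i - int s))" for i
  \<comment> \<open>With period \<open>2 * q\<close> the terms for \<open>s\<close> and
    \<open>2 * q - s\<close> coincide in pairs, whence the factor 2. The other four offsets, from
    \<open>q - 3\<close> to \<open>q + 3\<close>, are spaced by 2.\<close>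
  have B: "2 * B i + f (i + q - 1) + f (i + q + 1) + f (i + q + 3) + f (i + q - 3) = 0" for i
  proof -
    have "(\<Sum>s = 1..t - 1. f (i + int s) + f (i - int s) + f (i + (2 * q - int s)) + f (i - (2 * q - int s)))
      = (\<Sum>s = 1..t - 1. 2 * (f (i + int s) + f (i - int s)))"
    proof (rule sum.cong)
      fix s
      show "f (i + int s) + f (i - int s) + f (i + (2 * q - int s)) + f (i - (2 * q - int s))
        = 2 * (f (i + int s) + f (i - int s))"
        using per2[of "i - int s"] per2'[of "i + int s"] by (simp add: algebra_simps)
    qed simp
    then show ?thesis
      using zero[of i] per2[of "i - (q - 1)"] per2[of "i - (q + 3)"]
      unfolding nbr_sum_def B_def by (simp add: sum_distrib_left algebra_simps)
  qed
  define y where "y i = f i - f (i + 2)" for i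
  have By: "B i - B (i + 2) = (\<Sum>s = 1..t - 1. y (i + int s) + y (i - int s))" for i
    unfolding B_def y_def sum_subtractf[symmetric] by (rule sum.cong) (auto simp: algebra_simps)
  have step: "\<exists>w\<in>int_module.span (range y). f j - f (j + 8) = 2 * w" for j
  proof
    \<comment> \<open>The four single terms now sit at \<open>j\<close>, \<open>j + 2\<close>,
      \<open>j + 4\<close>, \<open>j + 6\<close>; subtracting the equation at \<open>i + 2\<close>
      leaves only \<open>f j - f (j + 8)\<close>.\<close>
    define i where "i = j - q + 3"
    have "f j - f (j + 8) = 2 * - (B i - B (i + 2))"
      using B[of i] B[of "i + 2"] by (simp add: i_def algebra_simps)
    then show "f j - f (j + 8) = 2 * - (\<Sum>s = 1..t - 1. y (i + int s) + y (i - int s))"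
      by (simp only: By)
    show "- (\<Sum>s = 1..t - 1. y (i + int s) + y (i - int s)) \<in> int_module.span (range y)"
      by (intro int_module.span_neg int_module.span_sum int_module.span_add int_module.span_base) auto
  qed
  \<comment> \<open>\<open>f j - f (j + 8)\<close> is \<open>(1 + T\<^sup>2)(1 + T\<^sup>4) y\<close>; inverting that operator amounts to telescoping
    until \<open>8 * k\<close> is congruent to 2 modulo the period \<open>2 * q\<close>\<close>
  have steps: "\<exists>w\<in>int_module.span (range y). f j - f (j + 8 * int k) = 2 * w" for j k
  proof (induction k)
    case 0
    show ?case by (intro bexI[of _ 0]) (auto simp: int_module.span_zero)
  next
    case (Suc k)
    obtain v where v: "v \<in> int_module.span (range y)" "f j - f (j + 8 * int k) = 2 * v"
      using Suc by blast
    obtain w where w: "w \<in> int_module.span (range y)"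
      "f (j + 8 * int k) - f (j + 8 * int k + 8) = 2 * w"
      using step by blast
    show ?case
    proof
      show "v + w \<in> int_module.span (range y)" using v w by (intro int_module.span_add)
      show "f j - f (j + 8 * int (Suc k)) = 2 * (v + w)" using v w by (simp add: algebra_simps)
    qed
  qed
  \<comment> \<open>Since \<open>q\<close> is odd, 4 has an inverse \<open>k\<close> modulo
    \<open>q\<close>: \<open>4 * k = q + 1\<close> or \<open>4 * k = 3 * q + 1\<close>, according to
    \<open>q\<close> modulo 4.\<close>
  obtain k :: nat and l :: int where kl: "8 * int k = 2 + l * (2 * q)"
  proof (cases "q mod 4 = 3")
    case True
    then have "q = 4 * (q div 4) + 3" using div_mult_mod_eq[of q 4] by simp
    then have "8 * int (nat (q div 4 + 1)) = 2 + 1 * (2 * q)" using \<open>q > 0\<close> by simp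
    then show ?thesis by (rule that)
  next
    case False
    then have "q mod 4 = 1" using \<open>odd q\<close> by presburger
    then have "q = 4 * (q div 4) + 1" using div_mult_mod_eq[of q 4] by simp
    then have "8 * int (nat (3 * (q div 4) + 1)) = 2 + 3 * (2 * q)" using \<open>q > 0\<close> by simp
    then show ?thesis by (rule that)
  qed
  have y2: "\<exists>w\<in>int_module.span (range y). y j = 2 * w" for j
  proof -
    have "j + 8 * int k = j + 2 + l * (2 * q)" using kl by simp
    then have "f (j + 8 * int k) = f (j + 2 + l * (2 * q))" by (rule arg_cong)
    also have "\<dots> = f (j + 2)" by (rule periodic_int_mult) (rule per2)
    finally show ?thesis using steps[of j k] by (simp add: y_def)
  qed
  have "finite (range y)"
  proof (rule finite_range_periodic)
    show "y (j + 2 * q) = y j" for j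
      using per2[of j] per2[of "j + 2"] by (simp add: y_def algebra_simps)
  qed (use \<open>q > 0\<close> in simp)
  then have "range y \<subseteq> {0}" by (rule int_span_two_divisible_imp_zero) (use y2 in auto)
  then have "y i = 0" by blast
  then show ?thesis by (simp add: y_def)
qed

text \<open>Only parities of offsets matter. For \<open>t\<close> even, \<open>1..t - 1\<close> has
  \<open>t/2\<close> odd and \<open>t/2 - 1\<close> even members, each counted four times; the
  offsets around \<open>q\<close> are even and contribute the missing
  \<open>4 * f i\<close>.\<close>

lemma nbr_sum_periodic_2:
  assumes "odd q" and "even t" and "t > 0" and per: "\<And>i. f (i + 2) = f i"
  shows "nbr_sum t q f i = 2 * real t * (f i + f (i + 1))"
proof -
  have eq: "f j = (if even (j - i) then f i else f (i + 1))" for j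
  proof (cases "even (j - i)")
    case True
    then have "f j = f (i + (j - i) div 2 * 2)" by simp
    also have "\<dots> = f i" by (rule periodic_int_mult) (rule per)
    finally show ?thesis using True by simp
  next
    case False
    then have "f j = f (i + 1 + (j - i - 1) div 2 * 2)" by simp
    also have "\<dots> = f (i + 1)" by (rule periodic_int_mult) (rule per)
    finally show ?thesis using False by simp
  qed
  have inner: "f (i + int s) + f (i - int s) + f (i + (2 * q - int s)) + f (i - (2 * q - int s))
      = 4 * (if even s then f i else f (i + 1))" for s
    using eq[of "i + int s"] eq[of "i - int s"] eq[of "i + (2 * q - int s)"]
      eq[of "i - (2 * q - int s)"] by simp
  have outer: "f (i + (q - 1)) + f (i - (q - 1)) + f (i + (q + 3)) + f (i - (q + 3)) = 4 * f i"
    using eq[of "i + (q - 1)"] eq[of "i - (q - 1)"] eq[of "i + (q + 3)"] eq[of "i - (q + 3)"] \<open>odd q\<close>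
    by simp
  have alt: "(\<Sum>s = 1..2 * m + 1. if even s then a else b) = real m * a + real (m + 1) * b"
    for m :: nat and a b :: real
    by (induction m) (auto simp: algebra_simps)
  obtain m where m: "t = 2 * (m + 1)"
    using \<open>even t\<close> \<open>t > 0\<close> by (metis Suc_eq_plus1 dvdE mult_0_right not0_implies_Suc not_gr_zero)
  have "nbr_sum t q f i = 4 * (\<Sum>s = 1..t - 1. if even s then f i else f (i + 1)) + 4 * f i"
    unfolding nbr_sum_def inner sum_distrib_left[symmetric] using outer by simp
  also have "t - 1 = 2 * m + 1" by (simp add: m)
  finally show ?thesis unfolding alt m by (simp add: algebra_simps)
qed

section \<open>Neighbour sums in the circulant graph\<close>

lemma sum_Circ_neighbours:
  fixes x :: "nat \<Rightarrow> 'a::comm_monoid_add"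
  assumes "i < n" and S: "\<And>s. s \<in> S \<Longrightarrow> 0 < s \<and> 2 * s < n"
  shows "(\<Sum>j | (i, j) \<in> parcs (Circ n S). x j)
    = (\<Sum>s\<in>S. x (nat ((int i + int s) mod int n)) + x (nat ((int i - int s) mod int n)))"
proof -
  have fin: "finite S" by (rule finite_subset[of _ "{..<n}"]) (use S in force)+
  \<comment> \<open>The residues of \<open>j - i\<close> over all neighbours \<open>j\<close>. As
    \<open>2 * s < n\<close> excludes \<open>n/2\<close>, the residues \<open>s\<close> and
    \<open>n - s\<close> never collide.\<close>
  define D where "D = int ` S \<union> (\<lambda>s. int n - int s) ` S"
  have D: "0 < d \<and> d < int n" if "d \<in> D" for d
    using that S by (force simp: D_def)
  have mod_neg: "(- a) mod int n = int n - a mod int n" if "a mod int n \<noteq> 0" for a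
    using that \<open>i < n\<close> by (simp add: zmod_zminus1_eq_if)
  have arc: "(i, j) \<in> parcs (Circ n S) \<longleftrightarrow> j < n \<and> (int j - int i) mod int n \<in> D" for j
  proof (cases "j < n \<and> i \<noteq> j")
    case True
    have nz: "(int i - int j) mod int n \<noteq> 0"
      using True \<open>i < n\<close> by (auto simp: mod_eq_0_iff_dvd mod_eq_dvd_iff[symmetric])
    have "(int j - int i) mod int n = int n - (int i - int j) mod int n"
      using mod_neg[OF nz] by simp
    then show ?thesis using True \<open>i < n\<close> by (auto simp: Circ_def D_def image_iff)
  next
    case False
    then show ?thesis using D[of 0] by (auto simp: Circ_def)
  qed
  have shift: "(int i + (int n - int s)) mod int n = (int i - int s) mod int n" for s
    using mod_add_self2[of "int i - int s" "int n"] by (simp add: algebra_simps)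
  have "(\<Sum>j | (i, j) \<in> parcs (Circ n S). x j) = (\<Sum>d\<in>D. x (nat ((int i + d) mod int n)))"
  proof (rule sum.reindex_bij_witness[where i = "\<lambda>d. nat ((int i + d) mod int n)"
        and j = "\<lambda>j. (int j - int i) mod int n"])
    fix d assume d: "d \<in> D"
    have "((int i + d) mod int n - int i) mod int n = d"
      using D[OF d] by (simp add: mod_diff_left_eq)
    then show "(int (nat ((int i + d) mod int n)) - int i) mod int n = d"
      and "nat ((int i + d) mod int n) \<in> {j. (i, j) \<in> parcs (Circ n S)}"
      using \<open>i < n\<close> d by (simp_all add: arc nat_less_iff)
  qed (simp_all add: arc mod_add_right_eq)
  also have "\<dots> = (\<Sum>d\<in>int ` S. x (nat ((int i + d) mod int n)))
      + (\<Sum>d\<in>(\<lambda>s. int n - int s) ` S. x (nat ((int i + d) mod int n)))"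
    unfolding D_def using fin
  proof (intro sum.union_disjoint)
    have "int s \<noteq> int n - int s'" if "s \<in> S" "s' \<in> S" for s s'
      using S[OF that(1)] S[OF that(2)] by linarith
    then show "int ` S \<inter> (\<lambda>s. int n - int s) ` S = {}" by blast
  qed simp_all
  also have "\<dots> = (\<Sum>s\<in>S. x (nat ((int i + int s) mod int n)))
      + (\<Sum>s\<in>S. x (nat ((int i + (int n - int s)) mod int n)))"
    by (subst (1 2) sum.reindex) (auto simp: inj_on_def)
  finally show ?thesis by (simp add: sum.distrib shift)
qed

text \<open>The bound on \<open>q\<close> puts \<open>q + 3\<close> below
  \<open>2 * q - (t - 1)\<close>, so the blocks are disjoint; the reflection \<open>s\<close> to
  \<open>2 * q - s\<close> maps the lowest block onto the highest.\<close>

lemma sum_S2: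
  fixes g :: "nat \<Rightarrow> 'a::comm_monoid_add"
  assumes n: "n = 4 * q" and q: "q \<ge> t + 3" and "t \<ge> 1"
  shows "(\<Sum>s\<in>S2 t n. g s) = (\<Sum>s = 1..t - 1. g s + g (2 * q - s)) + (g (q - 1) + g (q + 3))"
proof -
  have "S2 t n = {1..t - 1} \<union> ({2 * q - (t - 1)..2 * q - 1} \<union> {q - 1, q + 3})"
    by (auto simp: S2_def n)
  also have "(\<Sum>s\<in>\<dots>. g s) = (\<Sum>s = 1..t - 1. g s)
      + (\<Sum>s\<in>{2 * q - (t - 1)..2 * q - 1} \<union> {q - 1, q + 3}. g s)"
    using q by (intro sum.union_disjoint) auto
  also have "(\<Sum>s\<in>{2 * q - (t - 1)..2 * q - 1} \<union> {q - 1, q + 3}. g s)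
      = (\<Sum>s = 2 * q - (t - 1)..2 * q - 1. g s) + (\<Sum>s\<in>{q - 1, q + 3}. g s)"
    using q by (intro sum.union_disjoint) auto
  also have "(\<Sum>s = 2 * q - (t - 1)..2 * q - 1. g s) = (\<Sum>s = 1..t - 1. g (2 * q - s))"
    by (rule sum.reindex_bij_witness[of _ "\<lambda>s. 2 * q - s" "\<lambda>s. 2 * q - s"]) (use q in auto)
  finally show ?thesis using q by (simp add: sum.distrib add.assoc)
qed

section \<open>The kernel of the adjacency matrix\<close>

lemma adjacency_matrix_Circ:
  "adjacency_matrix (Circ n S) = mat n n (\<lambda>(i, j). if (i, j) \<in> parcs (Circ n S) then 1 else 0)"
  by (rule eq_matI) (auto simp: adjacency_matrix_def Circ_def Let_def)

lemma mat_kernel_adjacency_Circ: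
  "x \<in> mat_kernel (adjacency_matrix (Circ n S)) \<longleftrightarrow>
     x \<in> carrier_vec n \<and> (\<forall>i<n. (\<Sum>j | (i, j) \<in> parcs (Circ n S). vec_index x j) = 0)"
proof -
  have "row (adjacency_matrix (Circ n S)) i \<bullet> x
      = (\<Sum>j | (i, j) \<in> parcs (Circ n S). vec_index x j)"
    if x: "x \<in> carrier_vec n" and "i < n" for i
  proof -
    have "row (adjacency_matrix (Circ n S)) i \<bullet> x
        = (\<Sum>j = 0..<n. if (i, j) \<in> parcs (Circ n S) then vec_index x j else 0)"
      using that by (auto simp: scalar_prod_def adjacency_matrix_Circ intro!: sum.cong)
    also have "\<dots> = (\<Sum>j\<in>{j \<in> {0..<n}. (i, j) \<in> parcs (Circ n S)}. vec_index x j)"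
      by (rule sum.inter_filter[symmetric]) simp
    also have "{j \<in> {0..<n}. (i, j) \<in> parcs (Circ n S)} = {j. (i, j) \<in> parcs (Circ n S)}"
      by (auto simp: Circ_def)
    finally show ?thesis .
  qed
  moreover have "adjacency_matrix (Circ n S) \<in> carrier_mat n n"
    by (simp add: adjacency_matrix_Circ)
  ultimately show ?thesis
    by (auto simp: mat_kernel vec_eq_iff)
qed

lemma kernel_dim_eq_1:
  fixes A :: "'a::field mat"
  assumes A: "A \<in> carrier_mat nr nc" and v: "v \<in> mat_kernel A" "v \<noteq> 0\<^sub>v nc"
    and span: "\<And>x. x \<in> mat_kernel A \<Longrightarrow> \<exists>c. x = c \<cdot>\<^sub>v v"
  shows "kernel_dim A = 1"
proof -
  interpret kernel nr nc A by unfold_locales (rule A)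
  have "Ker.span {v} = mat_kernel A"
  proof
    show "Ker.span {v} \<subseteq> mat_kernel A"
      using Ker.span_is_subset2[of "{v}"] v by simp
    show "mat_kernel A \<subseteq> Ker.span {v}"
    proof
      fix x assume "x \<in> mat_kernel A"
      then obtain c where "x = c \<cdot>\<^sub>v v" using span by blast
      moreover have "submodule class_ring (Ker.span {v}) VK"
        using Ker.span_is_submodule[of "{v}"] v by simp
      moreover have "v \<in> Ker.span {v}"
        using Ker.in_own_span[of "{v}"] v by simp
      ultimately show "x \<in> Ker.span {v}"
        using submodule.smult_closed[of class_ring "Ker.span {v}" VK c v] by simp
    qed
  qed
  then show ?thesis using Ker.dim1I[of v] v by simp
qed

lemma circulant_graph_Circ:
  assumes "n \<ge> 2" and "S \<subseteq> {1..n div 2}"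
  shows "circulant_graph (Circ n S)"
proof -
  let ?G = "with_proj (Circ n S)"
  interpret pair_graph "Circ n S" by (rule pair_graph_Circ)
  have "pre_digraph.digraph_isomorphism ?G
      \<lparr>iso_verts = id, iso_arcs = id, iso_head = snd, iso_tail = fst\<rparr>"
    using wf_digraph_wp_iff by (auto simp: digraph_isomorphism_def wf_digraph_axioms)
  moreover have "?G = app_iso \<lparr>iso_verts = id, iso_arcs = id, iso_head = snd, iso_tail = fst\<rparr> ?G"
    by (simp add: app_iso_def with_proj_def)
  ultimately have "digraph_iso ?G ?G" unfolding digraph_iso_def by blast
  then show ?thesis unfolding circulant_graph_def using assms by blast
qed

section \<open>Regularity, the alternating null vector and the nut property\<close>

theorem theorem5p1:
  fixes t n :: nat
  assumes "t \<ge> 4" and "even t" and "n \<ge> 4 * t + 12" and "n mod 8 = 4"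
  shows "regular_graph (4 * t) (Circ n (S2 t n))
    \<and> circulant_nut_graph (Circ n (S2 t n))
    \<and> card (pverts (Circ n (S2 t n))) = n"
proof -
  define q where "q = n div 4"
  have n: "n = 4 * q" and "odd q" and q: "q \<ge> t + 3"
    using assms unfolding q_def by presburger+
  let ?G = "Circ n (S2 t n)"
  have verts: "pverts ?G = {0..<n}" by (simp add: Circ_def)
  have S: "0 < s \<and> 2 * s < n" if "s \<in> S2 t n" for s
    using that assms(1) q by (auto simp: S2_def n)
  have nbrs: "(\<Sum>j | (i, j) \<in> parcs ?G. x (int j)) = nbr_sum t (int q) x (int i)"
    if "i < n" and per: "\<And>j. x (j + int n) = x j" for i and x :: "int \<Rightarrow> real"
  proof -
    have x_mod: "x (int (nat (j mod int n))) = x j" for j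
    proof -
      have "x j = x (j mod int n + (j div int n) * int n)" by simp
      also have "\<dots> = x (j mod int n)" by (rule periodic_int_mult) (rule per)
      finally show ?thesis using \<open>i < n\<close> by simp
    qed
    have "(\<Sum>j | (i, j) \<in> parcs ?G. x (int j)) = (\<Sum>s\<in>S2 t n. x (int i + int s) + x (int i - int s))"
      using sum_Circ_neighbours[OF \<open>i < n\<close> S, where x = "\<lambda>j. x (int j)"] by (simp only: x_mod)
    also have "\<dots> = nbr_sum t (int q) x (int i)"
    proof -
      have "(\<Sum>s = 1..t - 1. x (int i + int s) + x (int i - int s)
            + (x (int i + int (2 * q - s)) + x (int i - int (2 * q - s))))
          = (\<Sum>s = 1..t - 1. x (int i + int s) + x (int i - int s)
            + x (int i + (2 * int q - int s)) + x (int i - (2 * int q - int s)))"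
        using q by (intro sum.cong) (auto simp: of_nat_diff)
      then show ?thesis
        using q \<open>t \<ge> 4\<close> by (simp add: nbr_sum_def sum_S2[OF n q] of_nat_diff)
    qed
    finally show ?thesis .
  qed
  have "out_degree (with_proj ?G) i = 4 * t" if "i < n" for i
  proof -
    have "out_degree (with_proj ?G) i = card {j. (i, j) \<in> parcs ?G}"
      unfolding out_degree_def out_arcs_def
      by (rule bij_betw_same_card[of snd]) (auto simp: bij_betw_def inj_on_def image_iff)
    \<comment> \<open>Summing the constant 1 over the neighbours counts them:
      \<open>4 * (t - 1) + 4\<close>.\<close>
    also have "\<dots> = 4 * t"
      using sum_Circ_neighbours[OF that S, where x = "\<lambda>_. 1 :: nat"]
        sum_S2[OF n q, where g = "\<lambda>_. 2 :: nat"] \<open>t \<ge> 4\<close> by simp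
    finally show ?thesis .
  qed
  then have reg: "regular_graph (4 * t) ?G"
    by (simp add: regular_graph_def pair_graph_Circ verts)
  define v :: "real vec" where "v = vec n (\<lambda>i. (-1) ^ i)"
  have ker: "x = x $ 0 \<cdot>\<^sub>v v" if x: "x \<in> mat_kernel (adjacency_matrix ?G)" for x
  proof -
    \<comment> \<open>The \<open>n\<close>-periodic extension of \<open>x\<close> to the
      integers.\<close>
    define f where "f i = x $ nat (i mod int n)" for i
    have xf: "x $ i = f (int i)" if "i < n" for i using that by (simp add: f_def)
    have per: "f (i + int n) = f i" for i by (simp add: f_def)
    have zero: "nbr_sum t (int q) f i = 0" for i
    proof -
      have m: "nat (i mod int n) < n" using assms by (simp add: nat_less_iff)
      have "(\<Sum>j | (nat (i mod int n), j) \<in> parcs ?G. f (int j)) = 0"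
      proof -
        have "(\<Sum>j | (nat (i mod int n), j) \<in> parcs ?G. f (int j))
            = (\<Sum>j | (nat (i mod int n), j) \<in> parcs ?G. x $ j)"
          by (rule sum.cong) (auto simp: xf Circ_def)
        then show ?thesis using x m by (simp add: mat_kernel_adjacency_Circ)
      qed
      then have "nbr_sum t (int q) f (i mod int n) = 0"
        using nbrs[where x = f, OF m per] m by simp
      \<comment> \<open>The equation is known at residues only; \<open>nbr_sum\<close> inherits the
        period \<open>n\<close>, which carries it to every integer.\<close>
      moreover have "nbr_sum t (int q) f (i mod int n + (i div int n) * int n)
        = nbr_sum t (int q) f (i mod int n)"
      proof (rule periodic_int_mult)
        show "nbr_sum t (int q) f (j + int n) = nbr_sum t (int q) f j" for j
        proof -
          have "f (j + int n + a) = f (j + a)" "f (j + int n - a) = f (j - a)" for a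
            using per[of "j + a"] per[of "j - a"] by (simp_all add: algebra_simps)
          then show ?thesis by (simp add: nbr_sum_def)
        qed
      qed
      ultimately show ?thesis by simp
    qed
    have per2: "f (i + 2) = f i" for i
      by (rule nbr_sum_eq_0_imp_periodic_2[OF _ _ _ zero]) (use \<open>odd q\<close> q per n in auto)
    have alt: "f (i + 1) = - f i" for i
      using nbr_sum_periodic_2[where f = f, OF _ \<open>even t\<close> _ per2, of "int q" i] zero[of i] \<open>odd q\<close> \<open>t \<ge> 4\<close>
      by simp
    have "f (int i) = f 0 * (-1) ^ i" for i
    proof (induction i)
      case (Suc i)
      then show ?case using alt[of "int i"] by (simp add: add.commute)
    qed simp
    then show ?thesis
      using x xf assms by (intro eq_vecI) (auto simp: v_def mat_kernel_adjacency_Circ)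
  qed
  have v: "v \<in> mat_kernel (adjacency_matrix ?G)"
    unfolding mat_kernel_adjacency_Circ
  proof (intro conjI allI impI)
    fix i assume "i < n"
    \<comment> \<open>The alternating sign is well defined around the cycle because \<open>n\<close>
      is even, and \<open>f i + f (i + 1) = 0\<close>.\<close>
    define f :: "int \<Rightarrow> real" where "f i = (if even i then 1 else -1)" for i
    have "(\<Sum>j | (i, j) \<in> parcs ?G. v $ j) = (\<Sum>j | (i, j) \<in> parcs ?G. f (int j))"
      by (rule sum.cong) (auto simp: v_def f_def Circ_def)
    also have "\<dots> = nbr_sum t (int q) f (int i)"
      by (rule nbrs[OF \<open>i < n\<close>]) (simp add: f_def n)
    also have "\<dots> = 0"
      using nbr_sum_periodic_2[of "int q" t f "int i"] \<open>odd q\<close> \<open>even t\<close> \<open>t \<ge> 4\<close> by (simp add: f_def)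
    finally show "(\<Sum>j | (i, j) \<in> parcs ?G. v $ j) = 0" .
  qed (simp add: v_def)
  have v0: "v \<noteq> 0\<^sub>v n"
  proof
    assume "v = 0\<^sub>v n"
    then have "v $ 0 = 0" using assms by simp
    then show False using assms by (simp add: v_def)
  qed
  have "kernel_dim (adjacency_matrix ?G) = 1"
    by (rule kernel_dim_eq_1[of _ n n, OF _ v v0]) (use ker in \<open>auto simp: adjacency_matrix_Circ\<close>)
  moreover have "x $ i \<noteq> 0"
    if "x \<in> mat_kernel (adjacency_matrix ?G)" "x \<noteq> 0\<^sub>v n" "i < n" for x i
  proof
    assume "x $ i = 0"
    have x: "x = x $ 0 \<cdot>\<^sub>v v" using that(1) by (rule ker)
    \<comment> \<open>Every entry of a kernel vector is its first entry up to sign, so one zero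
      entry forces all to vanish.\<close>
    have "x $ i = x $ 0 * (-1) ^ i"
      by (subst x) (use that(3) in \<open>simp add: v_def\<close>)
    then have "x $ 0 = 0" using \<open>x $ i = 0\<close> by simp
    then have "x = 0\<^sub>v n" using x by (simp add: v_def smult_vec_def zero_vec_def)
    then show False using that(2) by simp
  qed
  ultimately have "nut_graph ?G"
    using assms by (auto simp: nut_graph_def pair_graph_Circ verts)
  moreover have "circulant_graph ?G"
    using assms S2_subset by (intro circulant_graph_Circ) auto
  ultimately show ?thesis using reg verts by (simp add: circulant_nut_graph_def)
qed

end
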